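(* Let $(\mathcal{I},\mathcal{T},\mathcal{B})$ be a regular model checking problem over a finite alphabet $\Sigma$, and run the learning-based procedure described in the context with the learner being Angluin's $L^*$ algorithm or one of its variants by Rivest–Schapire or Kearns–Vazirani. If $T^*(I)$ is a regular language, then the procedure terminates after at most $k$ iterations (equivalence queries), where $k$ is the number of states of the minimal deterministic finite automaton recognising $T^*(I)$.
   Context: A regular model checking (RMC) problem is a triple $(\mathcal{I},\mathcal{T},\mathcal{B})$ where $\mathcal{I}$ and $\mathcal{B}$ are finite automata over a finite alphabet $\Sigma$ recognising regular languages $I,B\subseteq\Sigma^*$ (initial and bad configurations), and $\mathcal{T}$ is a length-preserving finite transducer (every transition reads one letter and writes one letter of $\Sigma$) recognising a relation $T\subseteq\Sigma^*\times\Sigma^*$ with $|x|=|y|$ for all $(x,y)\in T$. For $X\subseteq\Sigma^*$, $T(X)=\{y\mid \exists x\in X, (x,y)\in T\}$, and $T^*(I)$ denotes the set of words reachable from $I$ by zero or more applications of $T$. The problem asks whether $T^*(I)\cap B=\emptyset$. The procedure consists of a learner (an online automata learning algorithm that asks membership and equivalence queries and refines its hypothesis using the returned counterexamples) interacting with a teacher. Membership query on $w\in\Sigma^*$: the teacher answers yes iff $w\in T^*(I)$. Equivalence query on a candidate finite automaton $\mathcal{A}_h$ with language $A_h$ (one iteration): (1) if $I\not\subseteq A_h$, the teacher picks $w\in I\setminus A_h$ and returns it to the learner as a counterexample; (2) else if $A_h\cap B\neq\emptyset$, the teacher picks $w\in A_h\cap B$; if $w\in T^*(I)$ the procedure halts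 with output "false" and $w$, otherwise $w$ is returned to the learner as a counterexample; (3) else if $T(A_h)\not\subseteq A_h$, the teacher picks $(w,w')\in T$ with $w\in A_h$, $w'\notin A_h$; if $w\in T^*(I)$ it returns $w'$ as a counterexample, otherwise it returns $w$ as a counterexample; (4) otherwise the procedure halts with output "true" and $\mathcal{A}_h$. *)

theory Defs
  imports Main "HOL-Library.Sublist"
begin

section \<open>Finite automata and length-preserving transducers\<close>

text \<open>The alphabet is a type of class \<open>finite\<close>; words are lists.\<close>

record ('q, 'a) nfa =
  nfa_states :: "'q set"
  nfa_init :: "'q set"
  nfa_trans :: "('q \<times> 'a \<times> 'q) set"
  nfa_final :: "'q set"

definition is_nfa :: "('q, 'a) nfa \<Rightarrow> bool" where
  "is_nfa A \<longleftrightarrow> finite (nfa_states A) \<and> nfa_init A \<subseteq> nfa_states A \<and> nfa_final A \<subseteq> nfa_states A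
     \<and> nfa_trans A \<subseteq> nfa_states A \<times> UNIV \<times> nfa_states A"

fun nfa_path :: "('q, 'a) nfa \<Rightarrow> 'q \<Rightarrow> 'a list \<Rightarrow> 'q \<Rightarrow> bool" where
  "nfa_path A p [] q \<longleftrightarrow> p = q"
| "nfa_path A p (a # w) q \<longleftrightarrow> (\<exists>r. (p, a, r) \<in> nfa_trans A \<and> nfa_path A r w q)"

definition nfa_lang :: "('q, 'a) nfa \<Rightarrow> 'a list set" where
  "nfa_lang A = {w. \<exists>p\<in>nfa_init A. \<exists>q\<in>nfa_final A. nfa_path A p w q}"

text \<open>Every finite automaton is isomorphic to one whose states are natural numbers, so fixing the
  state type loses no language.\<close>

definition regular :: "'a list set \<Rightarrow> bool" where
  "regular L \<longleftrightarrow> (\<exists>A :: (nat, 'a) nfa. is_nfa A \<and> nfa_lang A = L)"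

text \<open>A transducer whose transitions read one letter and write one letter is a finite automaton
  over pairs of letters.\<close>

definition transducer_rel :: "('q, 'a \<times> 'a) nfa \<Rightarrow> ('a list \<times> 'a list) set" where
  "transducer_rel A = {(map fst w, map snd w) | w. w \<in> nfa_lang A}"

text \<open>Deterministic automata are complete: the transition function is total on the states.\<close>

record ('q, 'a) dfa =
  dfa_states :: "'q set"
  dfa_init :: "'q"
  dfa_next :: "'q \<Rightarrow> 'a \<Rightarrow> 'q"
  dfa_final :: "'q set"

definition is_dfa :: "('q, 'a) dfa \<Rightarrow> bool" where
  "is_dfa M \<longleftrightarrow> finite (dfa_states M) \<and> dfa_init M \<in> dfa_states M \<and> dfa_final M \<subseteq> dfa_states M
     \<and> (\<forall>q\<in>dfa_states M. \<forall>a. dfa_next M q a \<in> dfa_states M)"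

definition dfa_run :: "('q, 'a) dfa \<Rightarrow> 'a list \<Rightarrow> 'q" where
  "dfa_run M w = foldl (dfa_next M) (dfa_init M) w"

definition dfa_lang :: "('q, 'a) dfa \<Rightarrow> 'a list set" where
  "dfa_lang M = {w. dfa_run M w \<in> dfa_final M}"

text \<open>As for \<open>regular\<close>, comparing with automata over natural numbers covers all state types.\<close>

definition minimal_dfa :: "('q, 'a) dfa \<Rightarrow> 'a list set \<Rightarrow> bool" where
  "minimal_dfa M L \<longleftrightarrow> is_dfa M \<and> dfa_lang M = L
     \<and> (\<forall>M' :: (nat, 'a) dfa. is_dfa M' \<and> dfa_lang M' = L \<longrightarrow>
          card (dfa_states M) \<le> card (dfa_states M'))"


section \<open>Regular model checking problems\<close>

definition rmc_problem :: "('i, 'a) nfa \<Rightarrow> ('t, 'a \<times> 'a) nfa \<Rightarrow> ('b, 'a) nfa \<Rightarrow> bool" where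
  "rmc_problem \<I> \<T> \<B> \<longleftrightarrow> is_nfa \<I> \<and> is_nfa \<T> \<and> is_nfa \<B>"

definition reachable :: "('a list \<times> 'a list) set \<Rightarrow> 'a list set \<Rightarrow> 'a list set" where
  "reachable T I = T\<^sup>* `` I"


section \<open>The learning-based procedure\<close>

text \<open>
  A learner consults the membership oracle \<open>'a list \<Rightarrow> bool\<close> of the teacher. From a
  state it performs internal steps (\<open>lrn_work\<close>) as long as one is possible; otherwise it
  poses an equivalence query on the automaton \<open>lrn_hyp\<close>, and \<open>lrn_refine\<close>
  processes the counterexample returned.
\<close>

record ('s, 'q, 'a) learner =
  lrn_start :: "'s"
  lrn_work :: "('a list \<Rightarrow> bool) \<Rightarrow> 's \<Rightarrow> 's \<Rightarrow> bool"
  lrn_hyp :: "('a list \<Rightarrow> bool) \<Rightarrow> 's \<Rightarrow> ('q, 'a) dfa"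
  lrn_refine :: "('a list \<Rightarrow> bool) \<Rightarrow> 's \<Rightarrow> 'a list \<Rightarrow> 's"

datatype ('q, 'a) answer =
    Counterexample "'a list"
  | Halt_True "('q, 'a) dfa"
  | Halt_False "'a list"

inductive teacher_answer ::
  "'a list set \<Rightarrow> ('a list \<times> 'a list) set \<Rightarrow> 'a list set \<Rightarrow> ('q, 'a) dfa \<Rightarrow> ('q, 'a) answer \<Rightarrow> bool"
  for I :: "'a list set" and T :: "('a list \<times> 'a list) set" and B :: "'a list set"
    and H :: "('q, 'a) dfa"
where
  not_initial: "\<lbrakk>w \<in> I; w \<notin> dfa_lang H\<rbrakk> \<Longrightarrow> teacher_answer I T B H (Counterexample w)"
| bad_reachable: "\<lbrakk>I \<subseteq> dfa_lang H; w \<in> dfa_lang H \<inter> B; w \<in> reachable T I\<rbrakk> \<Longrightarrow>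
    teacher_answer I T B H (Halt_False w)"
| bad_unreachable: "\<lbrakk>I \<subseteq> dfa_lang H; w \<in> dfa_lang H \<inter> B; w \<notin> reachable T I\<rbrakk> \<Longrightarrow>
    teacher_answer I T B H (Counterexample w)"
| escape_reachable: "\<lbrakk>I \<subseteq> dfa_lang H; dfa_lang H \<inter> B = {};
    (w, w') \<in> T; w \<in> dfa_lang H; w' \<notin> dfa_lang H; w \<in> reachable T I\<rbrakk> \<Longrightarrow>
    teacher_answer I T B H (Counterexample w')"
| escape_unreachable: "\<lbrakk>I \<subseteq> dfa_lang H; dfa_lang H \<inter> B = {};
    (w, w') \<in> T; w \<in> dfa_lang H; w' \<notin> dfa_lang H; w \<notin> reachable T I\<rbrakk> \<Longrightarrow>
    teacher_answer I T B H (Counterexample w)"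
| invariant: "\<lbrakk>I \<subseteq> dfa_lang H; dfa_lang H \<inter> B = {}; T `` dfa_lang H \<subseteq> dfa_lang H\<rbrakk> \<Longrightarrow>
    teacher_answer I T B H (Halt_True H)"

datatype ('s, 'q, 'a) config =
    Running 's
  | Output_True "('q, 'a) dfa"
  | Output_False "'a list"

fun next_config ::
  "('s, 'q, 'a) learner \<Rightarrow> ('a list \<Rightarrow> bool) \<Rightarrow> 's \<Rightarrow> ('q, 'a) answer \<Rightarrow> ('s, 'q, 'a) config"
where
  "next_config \<L> mem s (Counterexample w) = Running (lrn_refine \<L> mem s w)"
| "next_config \<L> mem s (Halt_True H) = Output_True H"
| "next_config \<L> mem s (Halt_False w) = Output_False w"

text \<open>Both the learner and the teacher may have choices, hence steps are relations.\<close>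

inductive internal_step ::
  "('s, 'q, 'a) learner \<Rightarrow> 'a list set \<Rightarrow> ('a list \<times> 'a list) set \<Rightarrow>
   ('s, 'q, 'a) config \<Rightarrow> ('s, 'q, 'a) config \<Rightarrow> bool"
  for \<L> :: "('s, 'q, 'a) learner" and I :: "'a list set" and T :: "('a list \<times> 'a list) set"
where
  "lrn_work \<L> (\<lambda>w. w \<in> reachable T I) s s' \<Longrightarrow> internal_step \<L> I T (Running s) (Running s')"

inductive query_step ::
  "('s, 'q, 'a) learner \<Rightarrow> 'a list set \<Rightarrow> ('a list \<times> 'a list) set \<Rightarrow> 'a list set \<Rightarrow>
   ('s, 'q, 'a) config \<Rightarrow> ('s, 'q, 'a) config \<Rightarrow> bool"
  for \<L> :: "('s, 'q, 'a) learner" and I :: "'a list set" and T :: "('a list \<times> 'a list) set"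
    and B :: "'a list set"
where
  "\<lbrakk>\<nexists>s'. lrn_work \<L> (\<lambda>w. w \<in> reachable T I) s s';
    teacher_answer I T B (lrn_hyp \<L> (\<lambda>w. w \<in> reachable T I) s) r\<rbrakk> \<Longrightarrow>
   query_step \<L> I T B (Running s) (next_config \<L> (\<lambda>w. w \<in> reachable T I) s r)"

definition proc_step ::
  "('s, 'q, 'a) learner \<Rightarrow> 'a list set \<Rightarrow> ('a list \<times> 'a list) set \<Rightarrow> 'a list set \<Rightarrow>
   ('s, 'q, 'a) config \<Rightarrow> ('s, 'q, 'a) config \<Rightarrow> bool"
where
  "proc_step \<L> I T B c c' \<longleftrightarrow> internal_step \<L> I T c c' \<or> query_step \<L> I T B c c'"

text \<open>\<open>proc_run \<L> I T B n c\<close>: some run from the start reaches \<open>c\<close> having posed exactly \<open>n\<close>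
  equivalence queries.\<close>

inductive proc_run ::
  "('s, 'q, 'a) learner \<Rightarrow> 'a list set \<Rightarrow> ('a list \<times> 'a list) set \<Rightarrow> 'a list set \<Rightarrow>
   nat \<Rightarrow> ('s, 'q, 'a) config \<Rightarrow> bool"
  for \<L> :: "('s, 'q, 'a) learner" and I :: "'a list set" and T :: "('a list \<times> 'a list) set"
    and B :: "'a list set"
where
  start: "proc_run \<L> I T B 0 (Running (lrn_start \<L>))"
| internal: "\<lbrakk>proc_run \<L> I T B n c; internal_step \<L> I T c c'\<rbrakk> \<Longrightarrow> proc_run \<L> I T B n c'"
| query: "\<lbrakk>proc_run \<L> I T B n c; query_step \<L> I T B c c'\<rbrakk> \<Longrightarrow> proc_run \<L> I T B (Suc n) c'"

text \<open>Whatever the choices made, the run is finite, it can only end with an output, and it poses at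
  most \<open>k\<close> equivalence queries.\<close>

definition terminates_within ::
  "('s, 'q, 'a) learner \<Rightarrow> 'a list set \<Rightarrow> ('a list \<times> 'a list) set \<Rightarrow> 'a list set \<Rightarrow> nat \<Rightarrow> bool"
where
  "terminates_within \<L> I T B k \<longleftrightarrow>
     (\<nexists>c :: nat \<Rightarrow> ('s, 'q, 'a) config.
        c 0 = Running (lrn_start \<L>) \<and> (\<forall>i. proc_step \<L> I T B (c i) (c (Suc i)))) \<and>
     (\<forall>n s. proc_run \<L> I T B n (Running s) \<longrightarrow> (\<exists>c'. proc_step \<L> I T B (Running s) c')) \<and>
     (\<forall>n c. proc_run \<L> I T B n c \<longrightarrow> n \<le> k)"


section \<open>Observation tables\<close>

text \<open>A table is a pair \<open>(S, E)\<close> of access words and distinguishing suffixes; its entries are the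
  answers of the oracle. A row, as a function from \<open>E\<close> to truth values, is represented by
  the set of suffixes it maps to true.\<close>

type_synonym 'a table = "'a list set \<times> 'a list set"

definition row :: "('a list \<Rightarrow> bool) \<Rightarrow> 'a list set \<Rightarrow> 'a list \<Rightarrow> 'a list set" where
  "row mem E s = {e \<in> E. mem (s @ e)}"

inductive close_step :: "('a list \<Rightarrow> bool) \<Rightarrow> 'a table \<Rightarrow> 'a table \<Rightarrow> bool"
  for mem :: "'a list \<Rightarrow> bool"
where
  "\<lbrakk>s \<in> S; \<forall>s'\<in>S. row mem E (s @ [a]) \<noteq> row mem E s'\<rbrakk> \<Longrightarrow>
    close_step mem (S, E) (insert (s @ [a]) S, E)"

inductive consistency_step :: "('a list \<Rightarrow> bool) \<Rightarrow> 'a table \<Rightarrow> 'a table \<Rightarrow> bool"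
  for mem :: "'a list \<Rightarrow> bool"
where
  "\<lbrakk>s1 \<in> S; s2 \<in> S; row mem E s1 = row mem E s2; e \<in> E;
    mem (s1 @ [a] @ e) \<noteq> mem (s2 @ [a] @ e)\<rbrakk> \<Longrightarrow>
    consistency_step mem (S, E) (S, insert (a # e) E)"

definition access_word :: "('a list \<Rightarrow> bool) \<Rightarrow> 'a table \<Rightarrow> 'a list set \<Rightarrow> 'a list" where
  "access_word mem = (\<lambda>(S, E) q. SOME s. s \<in> S \<and> row mem E s = q)"

definition table_dfa :: "('a list \<Rightarrow> bool) \<Rightarrow> 'a table \<Rightarrow> ('a list set, 'a) dfa" where
  "table_dfa mem = (\<lambda>(S, E).
     \<lparr>dfa_states = row mem E ` S,
      dfa_init = row mem E [],
      dfa_next = (\<lambda>q a. row mem E (access_word mem (S, E) q @ [a])),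
      dfa_final = {row mem E s | s. s \<in> S \<and> mem s}\<rparr>)"


section \<open>Angluin's algorithm\<close>

definition angluin :: "('a table, 'a list set, 'a) learner" where
  "angluin =
     \<lparr>lrn_start = ({[]}, {[]}),
      lrn_work = (\<lambda>mem t t'. consistency_step mem t t' \<or> close_step mem t t'),
      lrn_hyp = table_dfa,
      lrn_refine = (\<lambda>mem (S, E) z. (S \<union> {p. prefix p z}, E))\<rparr>"


section \<open>The variant of Rivest and Schapire\<close>

text \<open>The rows of the access words stay pairwise distinct, so only closedness has to be restored.
  A counterexample \<open>z\<close> contributes a single suffix: with
  \<open>\<alpha> i = mem (s\<^sub>i @ drop i z)\<close>, where \<open>s\<^sub>i\<close> is the access word of the state
  that the hypothesis reaches on \<open>take i z\<close>, one has \<open>\<alpha> 0 \<noteq> \<alpha> (length z)\<close>, and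
  binary search finds \<open>i\<close> with \<open>\<alpha> i \<noteq> \<alpha> (Suc i)\<close>.\<close>

function binary_search :: "(nat \<Rightarrow> bool) \<Rightarrow> nat \<Rightarrow> nat \<Rightarrow> nat" where
  "binary_search \<alpha> lo hi =
     (if hi \<le> Suc lo then lo
      else let m = (lo + hi) div 2 in
        if \<alpha> m = \<alpha> lo then binary_search \<alpha> m hi else binary_search \<alpha> lo m)"
  by pat_completeness auto
termination by (relation "measure (\<lambda>(\<alpha>, lo, hi). hi - lo)") auto

declare binary_search.simps [simp del]

definition rs_refine :: "('a list \<Rightarrow> bool) \<Rightarrow> 'a table \<Rightarrow> 'a list \<Rightarrow> 'a table" where
  "rs_refine mem t z =
     (let \<alpha> = (\<lambda>i. mem (access_word mem t (dfa_run (table_dfa mem t) (take i z)) @ drop i z));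
          i = binary_search \<alpha> 0 (length z)
      in (fst t, insert (drop (Suc i) z) (snd t)))"

definition rivest_schapire :: "('a table, 'a list set, 'a) learner" where
  "rivest_schapire =
     \<lparr>lrn_start = ({[]}, {[]}),
      lrn_work = close_step,
      lrn_hyp = table_dfa,
      lrn_refine = rs_refine\<rparr>"


section \<open>The variant of Kearns and Vazirani\<close>

text \<open>In a classification tree inner nodes carry distinguishing suffixes and leaves carry access
  words; the left subtree is the rejecting one, the right subtree the accepting one.\<close>

datatype 'a ctree = Leaf "'a list" | Node "'a list" "'a ctree" "'a ctree"

fun leaves :: "'a ctree \<Rightarrow> 'a list set" where
  "leaves (Leaf s) = {s}"
| "leaves (Node d l r) = leaves l \<union> leaves r"

fun sift :: "('a list \<Rightarrow> bool) \<Rightarrow> 'a ctree \<Rightarrow> 'a list \<Rightarrow> 'a list" where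
  "sift mem (Leaf s) w = s"
| "sift mem (Node d l r) w = (if mem (w @ d) then sift mem r w else sift mem l w)"

text \<open>The label of the lowest common ancestor of two distinct leaves; the case of a
  single leaf is irrelevant.\<close>

fun lca_label :: "'a ctree \<Rightarrow> 'a list \<Rightarrow> 'a list \<Rightarrow> 'a list" where
  "lca_label (Leaf s) u v = []"
| "lca_label (Node d l r) u v =
     (if u \<in> leaves l \<and> v \<in> leaves l then lca_label l u v
      else if u \<in> leaves r \<and> v \<in> leaves r then lca_label r u v
      else d)"

fun replace_leaf :: "'a list \<Rightarrow> 'a ctree \<Rightarrow> 'a ctree \<Rightarrow> 'a ctree" where
  "replace_leaf u t' (Leaf s) = (if s = u then t' else Leaf s)"
| "replace_leaf u t' (Node d l r) = Node d (replace_leaf u t' l) (replace_leaf u t' r)"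

text \<open>The tree with root \<open>d\<close> separating \<open>u\<close> and \<open>v\<close>, which \<open>d\<close> is assumed to distinguish.\<close>

definition split_node :: "('a list \<Rightarrow> bool) \<Rightarrow> 'a list \<Rightarrow> 'a list \<Rightarrow> 'a list \<Rightarrow> 'a ctree" where
  "split_node mem d u v =
     (if mem (u @ d) then Node d (Leaf v) (Leaf u) else Node d (Leaf u) (Leaf v))"

definition ctree_dfa :: "('a list \<Rightarrow> bool) \<Rightarrow> 'a ctree \<Rightarrow> ('a list, 'a) dfa" where
  "ctree_dfa mem t =
     \<lparr>dfa_states = leaves t,
      dfa_init = [],
      dfa_next = (\<lambda>s a. sift mem t (s @ [a])),
      dfa_final = {s \<in> leaves t. mem s}\<rparr>"

text \<open>The first hypothesis of the algorithm, a single state with self-loops that accepts iff the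
  empty word is a member, is the automaton of the tree \<open>Leaf []\<close>. Its counterexample
  \<open>z\<close> gives the tree with root \<open>[]\<close> and leaves \<open>[]\<close> and \<open>z\<close>. Later, \<open>j\<close> is the first
  position where sifting \<open>take j z\<close> and running the hypothesis on it disagree.\<close>

fun kv_refine :: "('a list \<Rightarrow> bool) \<Rightarrow> 'a ctree \<Rightarrow> 'a list \<Rightarrow> 'a ctree" where
  "kv_refine mem (Leaf s) z = split_node mem [] s z"
| "kv_refine mem (Node d l r) z =
     (let t = Node d l r;
          sifted = (\<lambda>i. sift mem t (take i z));
          hyp = (\<lambda>i. dfa_run (ctree_dfa mem t) (take i z));
          j = (LEAST i. sifted i \<noteq> hyp i);
          u = sifted (j - 1)
      in replace_leaf u
           (split_node mem (z ! (j - 1) # lca_label t (sifted j) (hyp j)) u (take (j - 1) z)) t)"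

definition kearns_vazirani :: "('a ctree, 'a list, 'a) learner" where
  "kearns_vazirani =
     \<lparr>lrn_start = Leaf [],
      lrn_work = (\<lambda>mem t t'. False),
      lrn_hyp = ctree_dfa,
      lrn_refine = kv_refine\<rparr>"

end

theory Submission
  imports Defs
begin

text \<open>Every answer of the teacher that does not halt the procedure is a genuine counterexample to the
  hypothesis, that is, a word of the symmetric difference of its language and the reachable set.
  The rank of a learner's state is the number of states of its hypothesis. It is bounded by the
  number of states of every deterministic automaton of the reachable set, because the states of the
  hypothesis are separated by membership queries. Internal steps increase the rank, and a counterexample either
  increases it at once or keeps it and enables an internal step. Hence between two consecutive
  equivalence queries the rank grows, and it starts with 1.\<close>

section \<open>Termination by a bounded rank\<close>

text \<open>This excludes deadlock: a learner without internal steps can always pose its query, so a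
  run can only stop at an output.\<close>

lemma teacher_answer_exists: "\<exists>r. teacher_answer I T B H r"
proof (cases "I \<subseteq> dfa_lang H \<and> dfa_lang H \<inter> B = {} \<and> \<not> T `` dfa_lang H \<subseteq> dfa_lang H")
  case True
  then obtain w w' where "(w, w') \<in> T" "w \<in> dfa_lang H" "w' \<notin> dfa_lang H"
    by blast
  with True show ?thesis
    by (metis escape_reachable escape_unreachable)
next
  case False
  then show ?thesis
    by (metis subsetI ex_in_conv teacher_answer.intros(1-3) invariant)
qed

text \<open>Only the successor returned for a reachable \<open>v\<close> needs an argument: it is
  reachable by one more application of \<open>T\<close>.\<close>

lemma teacher_counterexample:
  assumes "teacher_answer I T B H (Counterexample w)"
  shows "w \<in> dfa_lang H \<longleftrightarrow> w \<notin> reachable T I"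
  using assms
proof cases
  case (escape_reachable v)
  then have "w \<in> reachable T I"
    unfolding reachable_def by (meson Image_iff rtrancl.rtrancl_into_rtrancl)
  with escape_reachable show ?thesis by simp
qed (auto simp: reachable_def)

lemma query_step_cases:
  assumes "query_step \<L> I T B c c'"
  obtains s where "c = Running s" "\<nexists>s'. lrn_work \<L> (\<lambda>w. w \<in> reachable T I) s s'"
    "(\<forall>s'. c' \<noteq> Running s')
     \<or> (\<exists>z. c' = Running (lrn_refine \<L> (\<lambda>w. w \<in> reachable T I) s z)
         \<and> (z \<in> dfa_lang (lrn_hyp \<L> (\<lambda>w. w \<in> reachable T I) s) \<longleftrightarrow> z \<notin> reachable T I))"
  using assms
proof cases
  case (1 s r)
  show ?thesis
  proof (cases r)
    case (Counterexample z)
    with 1 teacher_counterexample[of I T B _ z] show ?thesis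
      by (intro that[of s]) auto
  qed (use 1 that[of s] in auto)
qed

text \<open>Common core of the three learners, which only supply \<open>Inv\<close> and
  \<open>rank\<close>. The premise on refinement concerns states without internal steps, because
  queries are posed only there.\<close>

lemma terminates_within_by_rank:
  fixes rank :: "'s \<Rightarrow> nat" and \<L> :: "('s, 'q, 'a) learner"
    and I :: "'a list set" and T :: "('a list \<times> 'a list) set"
  defines "mem \<equiv> \<lambda>w. w \<in> reachable T I"
  assumes start: "Inv (lrn_start \<L>)"
    and bounds: "\<And>s. Inv s \<Longrightarrow> 0 < rank s \<and> rank s \<le> k"
    and work: "\<And>s s'. \<lbrakk>Inv s; lrn_work \<L> mem s s'\<rbrakk> \<Longrightarrow> Inv s' \<and> rank s < rank s'"
    and refine: "\<And>s z. \<lbrakk>Inv s; \<nexists>s'. lrn_work \<L> mem s s'; z \<in> dfa_lang (lrn_hyp \<L> mem s) \<longleftrightarrow> \<not> mem z\<rbrakk>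
      \<Longrightarrow> Inv (lrn_refine \<L> mem s z) \<and>
          (rank s < rank (lrn_refine \<L> mem s z) \<or>
           rank s \<le> rank (lrn_refine \<L> mem s z) \<and> (\<exists>s'. lrn_work \<L> mem (lrn_refine \<L> mem s z) s'))"
  shows "terminates_within \<L> I T B k"
proof -
  define unstable where "unstable s \<longleftrightarrow> (\<exists>s'. lrn_work \<L> mem s s')" for s
  \<comment> \<open>A pending internal step counts one half, because it will increase the rank.\<close>
  define pot where "pot s = 2 * rank s + (if unstable s then 1 else 0)" for s
  have int: "\<exists>s s'. c = Running s \<and> c' = Running s' \<and> lrn_work \<L> mem s s'"
    if "internal_step \<L> I T c c'" for c c'
    using that by cases (auto simp: mem_def)
  \<comment> \<open>Either alternative of the premise yields at least \<open>2 * rank s + 1\<close>: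
    the rank grows, or the pending step contributes 1.\<close>
  have ref: "Inv s' \<and> 2 * rank s < pot s'"
    if "query_step \<L> I T B (Running s) (Running s')" "Inv s" for s s'
    using that(1)
  proof (cases rule: query_step_cases)
    case (1 t)
    then show ?thesis
      using refine[of s] that(2) by (fastforce simp: mem_def pot_def unstable_def)
  qed
  have step: "Inv s' \<and> pot s < pot s'"
    if "proc_step \<L> I T B (Running s) (Running s')" "Inv s" for s s'
    using that(1) unfolding proc_step_def
  proof
    assume "internal_step \<L> I T (Running s) (Running s')"
    \<comment> \<open>The gain in rank adds at least 2, which outweighs the loss of the pending
      step.\<close>
    with int work[of s s'] that(2) show ?thesis
      by (fastforce simp: pot_def)
  next
    assume *: "query_step \<L> I T B (Running s) (Running s')"
    then have "\<not> unstable s"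
      by (auto simp: unstable_def mem_def elim: query_step_cases)
    with ref[OF * that(2)] show ?thesis
      by (simp add: pot_def)
  qed
  have src: "\<exists>s. c = Running s" if "proc_step \<L> I T B c c'" for c c'
    using that int by (auto simp: proc_step_def elim: query_step_cases)
  have "False" if c0: "c 0 = Running (lrn_start \<L>)" and cs: "\<And>i. proc_step \<L> I T B (c i) (c (Suc i))" for c
  proof -
    obtain s where s: "\<And>i. c i = Running (s i)"
      using src[OF cs] by metis
    have grow: "Inv (s i) \<and> i \<le> pot (s i)" for i
    proof (induction i)
      case 0
      with start c0 s[of 0] show ?case by simp
    next
      case (Suc i)
      with step[of "s i" "s (Suc i)"] cs[of i] s show ?case by fastforce
    qed
    \<comment> \<open>The potential never exceeds \<open>2 * k + 1\<close>.\<close>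
    from bounds[of "s (2 * k + 2)"] grow[of "2 * k + 2"] show False
      by (simp add: pot_def split: if_splits)
  qed
  moreover have "\<exists>c'. proc_step \<L> I T B (Running s) c'" for s
  proof (cases "unstable s")
    case True
    then show ?thesis
      unfolding unstable_def proc_step_def mem_def by (blast intro: internal_step.intros)
  next
    case False
    obtain r where "teacher_answer I T B (lrn_hyp \<L> mem s) r"
      using teacher_answer_exists by blast
    with False have "query_step \<L> I T B (Running s) (next_config \<L> mem s r)"
      unfolding unstable_def mem_def by (rule query_step.intros)
    then show ?thesis
      unfolding proc_step_def by blast
  qed
  \<comment> \<open>The count is bounded separately from \<open>pot\<close>, because an output
    carries no learner state.\<close>
  moreover have run: "n \<le> k \<and> (\<forall>s. c = Running s \<longrightarrow> Inv s \<and> 2 * n < pot s)"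
    if "proc_run \<L> I T B n c" for n c
    using that
  proof induction
    case start
    then show ?case
      using \<open>Inv (lrn_start \<L>)\<close> bounds[of "lrn_start \<L>"] by (simp add: pot_def)
  next
    case (internal n c c')
    from int[OF internal(2)] obtain s s' where
      "c = Running s" "c' = Running s'" "lrn_work \<L> mem s s'" by blast
    moreover from this internal(2) have "proc_step \<L> I T B (Running s) (Running s')"
      by (simp add: proc_step_def)
    ultimately show ?case
      using internal step[of s s'] by fastforce
  next
    case (query n c c')
    from query(2) obtain s where s: "c = Running s" and "\<not> unstable s"
      by (auto simp: unstable_def mem_def elim: query_step_cases)
    \<comment> \<open>In a stable state \<open>pot s\<close> is exactly \<open>2 * rank s\<close>,
      so \<open>2 * n < pot s\<close> becomes \<open>n < rank s\<close>, which leaves room for one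
      more query.\<close>
    with query(3) have *: "Inv s" "n < rank s"
      by (auto simp: pot_def)
    then show ?case
      using ref[of s] query(2) s bounds[of s] by fastforce
  qed
  ultimately show ?thesis
    unfolding terminates_within_def by blast
qed


section \<open>Observation tables\<close>

lemma dfa_run_Nil: "dfa_run M [] = dfa_init M"
  by (simp add: dfa_run_def)

lemma dfa_run_snoc: "dfa_run M (w @ [a]) = dfa_next M (dfa_run M w) a"
  by (simp add: dfa_run_def)

lemma dfa_run_take_Suc:
  "i < length z \<Longrightarrow> dfa_run M (take (Suc i) z) = dfa_next M (dfa_run M (take i z)) (z ! i)"
  by (simp add: take_Suc_conv_app_nth dfa_run_snoc)

lemma dfa_run_in_states: "is_dfa M \<Longrightarrow> dfa_run M w \<in> dfa_states M"
  by (induction w rule: rev_induct) (auto simp: dfa_run_Nil dfa_run_snoc is_dfa_def)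

lemma dfa_lang_append_cong:
  "dfa_run M u = dfa_run M v \<Longrightarrow> u @ e \<in> dfa_lang M \<longleftrightarrow> v @ e \<in> dfa_lang M"
  by (simp add: dfa_lang_def dfa_run_def)

text \<open>The function \<open>f\<close> factors through the state that \<open>M\<close> reaches.
  As \<open>S\<close> may be infinite, finiteness of the image also comes from
  \<open>M\<close>.\<close>

lemma card_le_dfa_states:
  assumes "is_dfa M"
    and f: "\<And>u v. dfa_run M u = dfa_run M v \<Longrightarrow> f u = f v"
  shows "finite (f ` S)" "card (f ` S) \<le> card (dfa_states M)"
proof -
  have fin: "finite (dfa_run M ` S)" and le: "card (dfa_run M ` S) \<le> card (dfa_states M)"
    using assms(1) dfa_run_in_states[OF assms(1)]
    by (auto simp: is_dfa_def intro: finite_subset card_mono)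
  have eq: "f ` S = (\<lambda>q. f (SOME u. dfa_run M u = q)) ` dfa_run M ` S"
    unfolding image_image by (rule image_cong[OF refl], rule f, rule sym, rule someI, rule refl)
  show "finite (f ` S)"
    unfolding eq using fin by simp
  show "card (f ` S) \<le> card (dfa_states M)"
    unfolding eq using card_image_le[OF fin] le order_trans by blast
qed

lemma rows_bounded:
  assumes "is_dfa M" "\<And>w. mem w \<longleftrightarrow> w \<in> dfa_lang M"
  shows "finite (row mem E ` S)" "card (row mem E ` S) \<le> card (dfa_states M)"
  by (rule card_le_dfa_states[OF assms(1)],
      simp add: row_def assms(2) cong: dfa_lang_append_cong)+

section \<open>Rows under a growing set of suffixes\<close>

lemma row_eq_antimono: "row mem E' u = row mem E' v \<Longrightarrow> E \<subseteq> E' \<Longrightarrow> row mem E u = row mem E v"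
  unfolding row_def by blast

lemma row_eqD: "row mem E u = row mem E v \<Longrightarrow> e \<in> E \<Longrightarrow> mem (u @ e) \<longleftrightarrow> mem (v @ e)"
  unfolding row_def by blast

text \<open>A row is the set of its accepted suffixes, so forgetting suffixes is intersection with
  \<open>E\<close>.\<close>

lemma rows_eq_image: "E \<subseteq> E' \<Longrightarrow> row mem E ` S = (\<lambda>r. r \<inter> E) ` row mem E' ` S"
  unfolding image_image by (rule image_cong) (auto simp: row_def)

lemma card_rows_mono:
  assumes "finite (row mem E' ` S)" "E \<subseteq> E'"
  shows "card (row mem E ` S) \<le> card (row mem E' ` S)"
  unfolding rows_eq_image[OF assms(2)] by (rule card_image_le[OF assms(1)])

text \<open>The rows of \<open>u\<close> and \<open>v\<close> over \<open>E'\<close> collapse under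
  intersection with \<open>E\<close>, and a non-injective map shrinks a finite set.\<close>

lemma card_rows_strict_mono:
  assumes fin: "finite (row mem E' ` S)" and "E \<subseteq> E'" "u \<in> S" "v \<in> S"
    "row mem E u = row mem E v" "row mem E' u \<noteq> row mem E' v"
  shows "card (row mem E ` S) < card (row mem E' ` S)"
proof -
  have "\<not> inj_on (\<lambda>r. r \<inter> E) (row mem E' ` S)"
    using assms by (fastforce simp: inj_on_def row_def)
  with fin have "card ((\<lambda>r. r \<inter> E) ` row mem E' ` S) \<noteq> card (row mem E' ` S)"
    using eq_card_imp_inj_on by blast
  with card_rows_mono[OF fin \<open>E \<subseteq> E'\<close>] rows_eq_image[OF \<open>E \<subseteq> E'\<close>, of mem S] show ?thesis
    by simp
qed

section \<open>The hypothesis automaton of a table\<close>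

lemma access_word:
  assumes "q \<in> row mem E ` S"
  shows "access_word mem (S, E) q \<in> S" "row mem E (access_word mem (S, E) q) = q"
proof -
  from assms have "\<exists>s. s \<in> S \<and> row mem E s = q" by blast
  from someI_ex[OF this] show "access_word mem (S, E) q \<in> S"
    "row mem E (access_word mem (S, E) q) = q"
    by (simp_all add: access_word_def)
qed

lemma close_step_iff:
  "(\<exists>t'. close_step mem (S, E) t') \<longleftrightarrow> (\<exists>s\<in>S. \<exists>a. row mem E (s @ [a]) \<notin> row mem E ` S)"
  by (auto simp: close_step.simps image_iff)

text \<open>Closedness ensures that \<open>access_word\<close> is only ever applied to a row of the
  table, where its choice is meaningful.\<close>

lemma table_dfa_run_in_rows:
  assumes "[] \<in> S" "\<nexists>t'. close_step mem (S, E) t'"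
  shows "dfa_run (table_dfa mem (S, E)) w \<in> row mem E ` S"
proof (induction w rule: rev_induct)
  case Nil
  with assms(1) show ?case by (simp add: dfa_run_Nil table_dfa_def)
next
  case (snoc a w)
  from access_word(1)[OF snoc] assms(2) show ?case
    unfolding close_step_iff by (auto simp: dfa_run_snoc table_dfa_def)
qed

text \<open>The suffix \<open>[]\<close> lets a row determine membership of its words, so finality
  does not depend on the representative.\<close>

lemma table_dfa_final_iff:
  assumes "q \<in> row mem E ` S" "[] \<in> E"
  shows "q \<in> dfa_final (table_dfa mem (S, E)) \<longleftrightarrow> [] \<in> q"
proof -
  have "[] \<in> row mem E s \<longleftrightarrow> mem s" for s
    using assms(2) by (simp add: row_def)
  with assms(1) show ?thesis
    unfolding table_dfa_def by fastforce
qed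

lemma card_rows_close_step:
  assumes "close_step mem (S, E) t'" "finite (row mem E ` fst t')"
  shows "card (row mem E ` S) < card (row mem (snd t') ` fst t')"
  using assms
  by cases (auto simp: card_insert_if image_iff)


section \<open>Angluin's algorithm\<close>

text \<open>If adding the prefixes of \<open>z\<close> changes neither the set of rows nor consistency, then the
  hypothesis reaches the row of each prefix of \<open>z\<close>, and thus it is right about \<open>z\<close>.\<close>

lemma table_dfa_correct_on_added_word:
  assumes "[] \<in> S" "[] \<in> E"
    and closed: "\<nexists>t'. close_step mem (S, E) t'"
    and rows: "row mem E ` (S \<union> {p. prefix p z}) = row mem E ` S"
    and consistent: "\<nexists>t'. consistency_step mem (S \<union> {p. prefix p z}, E) t'"
  shows "z \<in> dfa_lang (table_dfa mem (S, E)) \<longleftrightarrow> mem z"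
proof -
  let ?H = "table_dfa mem (S, E)"
  have run: "dfa_run ?H p = row mem E p" if "prefix p z" for p
    using that
  proof (induction p rule: rev_induct)
    case Nil
    show ?case by (simp add: dfa_run_Nil table_dfa_def)
  next
    case (snoc a p)
    then have p: "prefix p z" using append_prefixD by blast
    \<comment> \<open>The hypothesis leaves the row of \<open>p\<close> through \<open>?s\<close>.
      Both words lie in the enlarged table with equal rows, so consistency carries the equality over
      to their extensions by \<open>a\<close>.\<close>
    let ?s = "access_word mem (S, E) (row mem E p)"
    from p rows have "row mem E p \<in> row mem E ` S" by blast
    note s = access_word[OF this]
    have "mem (?s @ [a] @ e) = mem (p @ [a] @ e)" if "e \<in> E" for e
    proof (rule ccontr)
      assume "\<not> ?thesis"
      with s p that have "consistency_step mem (S \<union> {p. prefix p z}, E) (S \<union> {p. prefix p z}, insert (a # e) E)"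
        by (intro consistency_step.intros[of ?s _ p]) auto
      with consistent show False by blast
    qed
    then have "row mem E (?s @ [a]) = row mem E (p @ [a])"
      by (auto simp: row_def)
    with snoc.IH[OF p] show ?case
      by (simp add: dfa_run_snoc table_dfa_def)
  qed
  from run[of z] table_dfa_final_iff[OF table_dfa_run_in_rows[OF assms(1) closed] assms(2), of z]
  show ?thesis
    using assms(2) by (simp add: dfa_lang_def row_def)
qed

lemma angluin_terminates:
  fixes M :: "('q, 'a) dfa"
  assumes "is_dfa M" "dfa_lang M = reachable T I"
  shows "terminates_within angluin I T B (card (dfa_states M))"
proof -
  let ?mem = "\<lambda>w. w \<in> reachable T I"
  have mem: "\<And>w. ?mem w \<longleftrightarrow> w \<in> dfa_lang M"
    using assms(2) by simp
  note fin = rows_bounded(1)[OF assms(1) mem] and le = rows_bounded(2)[OF assms(1) mem]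
  define Inv where "Inv t \<longleftrightarrow> [] \<in> fst t \<and> [] \<in> snd t" for t :: "'a table"
  define rank where "rank t = card (row ?mem (snd t) ` fst t)" for t
  show ?thesis
  proof (rule terminates_within_by_rank[of Inv _ rank])
    show "Inv (lrn_start angluin)"
      by (simp add: Inv_def angluin_def)
    show "0 < rank t \<and> rank t \<le> card (dfa_states M)" if "Inv t" for t
      using that fin le by (auto simp: Inv_def rank_def card_gt_0_iff)
  next
    fix t t' assume inv: "Inv t" and "lrn_work angluin ?mem t t'"
    then consider "consistency_step ?mem t t'" | "close_step ?mem t t'"
      by (auto simp: angluin_def)
    then show "Inv t' \<and> rank t < rank t'"
    proof cases
      case 1
      then show ?thesis
      proof cases
        case (1 s1 S s2 E e a)
        \<comment> \<open>The new suffix splits two rows that coincided over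
          \<open>E\<close>.\<close>
        have "row ?mem (insert (a # e) E) s1 \<noteq> row ?mem (insert (a # e) E) s2"
          using 1 row_eqD[of ?mem "insert (a # e) E" s1 s2 "a # e"] by auto
        with 1 have "rank t < rank t'"
          using card_rows_strict_mono[OF fin, of E "insert (a # e) E" s1 S s2]
          by (auto simp: rank_def)
        with 1 inv show ?thesis by (simp add: Inv_def)
      qed
    next
      case 2
      then have "Inv t'"
        using inv by cases (auto simp: Inv_def)
      moreover from 2 have "rank t < rank t'"
        using card_rows_close_step[of ?mem "fst t" "snd t" t'] fin by (simp add: rank_def)
      ultimately show ?thesis ..
    qed
  next
    fix t z
    assume inv: "Inv t" and stable: "\<nexists>t'. lrn_work angluin ?mem t t'"
      and ce: "z \<in> dfa_lang (lrn_hyp angluin ?mem t) \<longleftrightarrow> \<not> ?mem z"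
    obtain S E where t: "t = (S, E)" by fastforce
    let ?S = "S \<union> {p. prefix p z}"
    have ref: "lrn_refine angluin ?mem t z = (?S, E)"
      by (simp add: angluin_def t)
    have sub: "row ?mem E ` S \<subseteq> row ?mem E ` ?S" by blast
    then have "rank t \<le> rank (?S, E)"
      unfolding rank_def t by (simp add: card_mono[OF fin sub])
    \<comment> \<open>If the rank stays, the prefixes of \<open>z\<close> bring no new row. Were the
      enlarged table consistent, the old hypothesis would already be right about
      \<open>z\<close>.\<close>
    moreover have "\<exists>t'. lrn_work angluin ?mem (?S, E) t'" if "\<not> rank t < rank (?S, E)"
    proof -
      from that have "row ?mem E ` ?S = row ?mem E ` S"
        using psubset_card_mono[OF fin, of "row ?mem E ` S" E ?S] sub
        by (auto simp: rank_def t)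
      then have "\<exists>t'. consistency_step ?mem (?S, E) t'"
        using table_dfa_correct_on_added_word[of S E ?mem z] inv stable ce
        by (auto simp: Inv_def t angluin_def)
      then show ?thesis by (auto simp: angluin_def)
    qed
    moreover have "Inv (?S, E)"
      using inv by (simp add: Inv_def t)
    ultimately show "Inv (lrn_refine angluin ?mem t z) \<and>
        (rank t < rank (lrn_refine angluin ?mem t z) \<or>
         rank t \<le> rank (lrn_refine angluin ?mem t z) \<and>
         (\<exists>t'. lrn_work angluin ?mem (lrn_refine angluin ?mem t z) t'))"
      unfolding ref by blast
  qed
qed


section \<open>The variant of Rivest and Schapire\<close>

text \<open>Whichever half is kept, \<alpha> still differs at its two ends; the search stops when
  they are adjacent.\<close>

lemma binary_search:
  assumes "lo < hi" "\<alpha> lo \<noteq> \<alpha> hi"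
  shows "binary_search \<alpha> lo hi < hi \<and> \<alpha> (binary_search \<alpha> lo hi) \<noteq> \<alpha> (Suc (binary_search \<alpha> lo hi))"
  using assms
proof (induction \<alpha> lo hi rule: binary_search.induct)
  case (1 \<alpha> lo hi)
  show ?case
  proof (cases "hi \<le> Suc lo")
    case True
    with 1(3,4) have "hi = Suc lo" by simp
    with 1(4) show ?thesis by (simp add: binary_search.simps)
  next
    case False
    define m where "m = (lo + hi) div 2"
    from False have m: "lo < m" "m < hi" by (auto simp: m_def)
    show ?thesis
    proof (cases "\<alpha> m = \<alpha> lo")
      case True
      moreover have "binary_search \<alpha> lo hi = binary_search \<alpha> m hi"
        by (subst binary_search.simps) (use False True in \<open>simp add: m_def Let_def\<close>)
      ultimately show ?thesis
        using 1(1)[OF False m_def] 1(4) m by simp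
    next
      case neq: False
      moreover have "binary_search \<alpha> lo hi = binary_search \<alpha> lo m"
        by (subst binary_search.simps) (use False neq in \<open>simp add: m_def Let_def\<close>)
      ultimately show ?thesis
        using 1(2)[OF False m_def] m by auto
    qed
  qed
qed

lemma access_word_row:
  "inj_on (row mem E) S \<Longrightarrow> s \<in> S \<Longrightarrow> access_word mem (S, E) (row mem E s) = s"
  by (meson access_word image_eqI inj_onD)

text \<open>At the position found, \<open>s i @ [z ! i]\<close> and \<open>s (Suc i)\<close> have
  the same row over \<open>E\<close>, but the suffix \<open>e\<close> separates them. As rows of
  \<open>S\<close> are distinct, no other word of \<open>S\<close> can match the extended one, so
  closedness fails.\<close>

lemma rs_refine_not_closed:
  assumes "[] \<in> S" "[] \<in> E" and inj: "inj_on (row mem E) S"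
    and closed: "\<nexists>t'. close_step mem (S, E) t'"
    and ce: "z \<in> dfa_lang (table_dfa mem (S, E)) \<longleftrightarrow> \<not> mem z"
  obtains e where "rs_refine mem (S, E) z = (S, insert e E)"
    "\<exists>t'. close_step mem (S, insert e E) t'"
proof -
  let ?H = "table_dfa mem (S, E)"
  define q where "q i = dfa_run ?H (take i z)" for i
  define s where "s i = access_word mem (S, E) (q i)" for i
  define \<alpha> where "\<alpha> i = mem (s i @ drop i z)" for i
  define i where "i = binary_search \<alpha> 0 (length z)"
  define e where "e = drop (Suc i) z"
  have "q i \<in> row mem E ` S" for i
    unfolding q_def by (rule table_dfa_run_in_rows[OF assms(1) closed])
  then have s: "s i \<in> S" "row mem E (s i) = q i" for i
    using access_word[of "q i" mem E S] by (simp_all add: s_def)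
  have "s 0 = []"
    using access_word_row[OF inj assms(1)] by (simp add: s_def q_def dfa_run_Nil table_dfa_def)
  then have \<alpha>0: "\<alpha> 0 \<longleftrightarrow> mem z"
    by (simp add: \<alpha>_def)
  \<comment> \<open>The two ends of the search are the oracle's and the hypothesis's verdicts on
    \<open>z\<close>, which differ for a counterexample.\<close>
  have "z \<in> dfa_lang ?H \<longleftrightarrow> [] \<in> q (length z)"
    using table_dfa_final_iff[OF table_dfa_run_in_rows[OF assms(1) closed] assms(2), of z]
    by (simp add: dfa_lang_def q_def)
  also have "\<dots> \<longleftrightarrow> \<alpha> (length z)"
    unfolding s(2)[symmetric] using assms(2) by (simp add: row_def \<alpha>_def)
  finally have "\<alpha> 0 \<noteq> \<alpha> (length z)"
    using ce \<alpha>0 by blast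
  moreover from this have "0 < length z"
    by (metis gr0I)
  ultimately have i: "i < length z" and neq: "\<alpha> i \<noteq> \<alpha> (Suc i)"
    using binary_search[of 0 "length z" \<alpha>] by (auto simp: i_def)
  have q_Suc: "q (Suc i) = row mem E (s i @ [z ! i])"
    using i by (simp add: q_def s_def dfa_run_take_Suc table_dfa_def)
  have "row mem (insert e E) (s i @ [z ! i]) \<noteq> row mem (insert e E) s'" if "s' \<in> S" for s'
  proof
    assume eq: "row mem (insert e E) (s i @ [z ! i]) = row mem (insert e E) s'"
    then have "q (Suc i) = row mem E s'"
      using row_eq_antimono[OF eq] q_Suc by blast
    with access_word_row[OF inj that] have "s (Suc i) = s'"
      by (simp add: s_def)
    \<comment> \<open>Since \<open>drop i z = z ! i # e\<close>, equal rows at \<open>e\<close>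
      would give \<alpha> the same value at \<open>i\<close> and \<open>Suc i\<close>.\<close>
    with row_eqD[OF eq, of e] neq i show False
      by (auto simp: \<alpha>_def e_def Cons_nth_drop_Suc)
  qed
  with s(1) have "close_step mem (S, insert e E) (insert (s i @ [z ! i]) S, insert e E)"
    by (intro close_step.intros) auto
  moreover have "rs_refine mem (S, E) z = (S, insert e E)"
    by (simp add: rs_refine_def Let_def e_def i_def \<alpha>_def[abs_def] s_def q_def)
  ultimately show thesis
    using that by blast
qed

lemma rivest_schapire_terminates:
  fixes M :: "('q, 'a) dfa"
  assumes "is_dfa M" "dfa_lang M = reachable T I"
  shows "terminates_within rivest_schapire I T B (card (dfa_states M))"
proof -
  let ?mem = "\<lambda>w. w \<in> reachable T I"
  have mem: "\<And>w. ?mem w \<longleftrightarrow> w \<in> dfa_lang M"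
    using assms(2) by simp
  note fin = rows_bounded(1)[OF assms(1) mem] and le = rows_bounded(2)[OF assms(1) mem]
  define Inv where "Inv t \<longleftrightarrow> [] \<in> fst t \<and> [] \<in> snd t \<and> inj_on (row ?mem (snd t)) (fst t)"
    for t :: "'a table"
  define rank where "rank t = card (row ?mem (snd t) ` fst t)" for t
  show ?thesis
  proof (rule terminates_within_by_rank[of Inv _ rank])
    show "Inv (lrn_start rivest_schapire)"
      by (simp add: Inv_def rivest_schapire_def)
    show "0 < rank t \<and> rank t \<le> card (dfa_states M)" if "Inv t" for t
      using that fin le by (auto simp: Inv_def rank_def card_gt_0_iff)
  next
    fix t t' assume inv: "Inv t" and "lrn_work rivest_schapire ?mem t t'"
    then have step: "close_step ?mem t t'"
      by (simp add: rivest_schapire_def)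
    then have "Inv t'"
    proof cases
      case (1 s S E a)
      then have "row ?mem E (s @ [a]) \<notin> row ?mem E ` S" by blast
      with 1 inv show ?thesis by (auto simp: Inv_def)
    qed
    moreover have "rank t < rank t'"
      using step card_rows_close_step[of ?mem "fst t" "snd t" t'] fin by (simp add: rank_def)
    ultimately show "Inv t' \<and> rank t < rank t'" ..
  next
    fix t z
    assume inv: "Inv t" and stable: "\<nexists>t'. lrn_work rivest_schapire ?mem t t'"
      and ce: "z \<in> dfa_lang (lrn_hyp rivest_schapire ?mem t) \<longleftrightarrow> \<not> ?mem z"
    obtain S E where t: "t = (S, E)" by fastforce
    from inv have inj: "inj_on (row ?mem E) S" and "[] \<in> S" "[] \<in> E"
      by (auto simp: Inv_def t)
    moreover from stable ce have "\<nexists>t'. close_step ?mem (S, E) t'"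
      "z \<in> dfa_lang (table_dfa ?mem (S, E)) \<longleftrightarrow> \<not> ?mem z"
      by (simp_all add: t rivest_schapire_def)
    ultimately obtain e where e: "rs_refine ?mem (S, E) z = (S, insert e E)"
      "\<exists>t'. close_step ?mem (S, insert e E) t'"
      using rs_refine_not_closed[of S E ?mem z] by metis
    have "inj_on (row ?mem (insert e E)) S"
      using inj row_eq_antimono[of ?mem "insert e E" _ _ E] by (meson inj_on_def subset_insertI)
    \<comment> \<open>The rows of \<open>S\<close> were distinct already, so the progress lies in
      the closing step that becomes possible.\<close>
    moreover have "rank t \<le> rank (S, insert e E)"
      using card_rows_mono[OF fin, of E "insert e E" S] by (auto simp: rank_def t)
    ultimately show "Inv (lrn_refine rivest_schapire ?mem t z) \<and>
        (rank t < rank (lrn_refine rivest_schapire ?mem t z) \<or>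
         rank t \<le> rank (lrn_refine rivest_schapire ?mem t z) \<and>
         (\<exists>t'. lrn_work rivest_schapire ?mem (lrn_refine rivest_schapire ?mem t z) t'))"
      using e inv by (simp add: rivest_schapire_def t Inv_def)
  qed
qed


section \<open>The variant of Kearns and Vazirani\<close>

text \<open>The invariant that makes the leaf words pairwise distinguishable and the leaves of
  sibling subtrees disjoint.\<close>

fun separating :: "('a list \<Rightarrow> bool) \<Rightarrow> 'a ctree \<Rightarrow> bool" where
  "separating mem (Leaf s) \<longleftrightarrow> True"
| "separating mem (Node d l r) \<longleftrightarrow> separating mem l \<and> separating mem r
     \<and> (\<forall>s\<in>leaves l. \<not> mem (s @ d)) \<and> (\<forall>s\<in>leaves r. mem (s @ d))"

lemma sift_in_leaves: "sift mem t w \<in> leaves t"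
  by (induction t) auto

lemma finite_leaves: "finite (leaves t)"
  by (induction t) auto

lemma leaves_nonempty: "leaves t \<noteq> {}"
  by (induction t) auto

lemma sift_leaf: "separating mem t \<Longrightarrow> s \<in> leaves t \<Longrightarrow> sift mem t s = s"
  by (induction t) auto

lemma mem_sift_root: "separating mem (Node d l r) \<Longrightarrow> mem (sift mem (Node d l r) w @ d) \<longleftrightarrow> mem (w @ d)"
  using sift_in_leaves[of mem l w] sift_in_leaves[of mem r w] by auto

text \<open>The lowest common ancestor of the two leaves is where sifting sends \<open>x\<close> and
  \<open>y\<close> into different subtrees.\<close>

lemma lca_label_distinguishes:
  assumes "separating mem t" "sift mem t x \<noteq> sift mem t y"
  shows "mem (x @ lca_label t (sift mem t x) (sift mem t y))
     \<noteq> mem (y @ lca_label t (sift mem t x) (sift mem t y))"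
  using assms
proof (induction t)
  case (Node d l r)
  have "sift mem l w \<in> leaves l - leaves r" "sift mem r w \<in> leaves r - leaves l" for w
    using Node.prems(1) sift_in_leaves[of mem l w] sift_in_leaves[of mem r w] by auto
  with Node show ?case by auto
qed simp

lemma replace_leaf_id: "u \<notin> leaves t \<Longrightarrow> replace_leaf u t' t = t"
  by (induction t) auto

lemma split_node_separating:
  "mem (u @ d) \<noteq> mem (v @ d) \<Longrightarrow> separating mem (split_node mem d u v)"
  by (auto simp: split_node_def)

lemma leaves_split_node: "leaves (split_node mem d u v) = {u, v}"
  by (auto simp: split_node_def)

text \<open>All labels on the path to its leaf classify \<open>v\<close> as they classify the leaf
  word, so only the new node has to separate the two.\<close>

lemma replace_leaf_split_node:
  assumes "separating mem t" "mem (sift mem t v @ d) \<noteq> mem (v @ d)"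
  defines "t' \<equiv> replace_leaf (sift mem t v) (split_node mem d (sift mem t v) v) t"
  shows "separating mem t' \<and> leaves t' = insert v (leaves t)"
  using assms(1,2) unfolding t'_def
proof (induction t)
  case (Leaf s)
  then show ?case by (auto simp: split_node_separating leaves_split_node)
next
  case (Node c l r)
  have "sift mem l v \<notin> leaves r" "sift mem r v \<notin> leaves l"
    using Node.prems(1) sift_in_leaves[of mem l v] sift_in_leaves[of mem r v] by auto
  with Node show ?case by (auto simp: replace_leaf_id)
qed

lemma ctree_dfa_run_in_leaves: "[] \<in> leaves t \<Longrightarrow> dfa_run (ctree_dfa mem t) w \<in> leaves t"
  by (cases w rule: rev_cases) (auto simp: dfa_run_Nil dfa_run_snoc ctree_dfa_def sift_in_leaves)

lemma ctree_dfa_lang_iff: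
  assumes "[] \<in> leaves t"
  shows "w \<in> dfa_lang (ctree_dfa mem t) \<longleftrightarrow> mem (dfa_run (ctree_dfa mem t) w)"
  using ctree_dfa_run_in_leaves[OF assms, of mem w] by (simp add: dfa_lang_def ctree_dfa_def)

text \<open>The empty word must be a leaf because it is the initial state of
  \<open>ctree_dfa\<close>. The root label \<open>[]\<close> makes sifting preserve membership, by
  \<open>mem_sift_root\<close>.\<close>

definition kv_inv :: "('a list \<Rightarrow> bool) \<Rightarrow> 'a ctree \<Rightarrow> bool" where
  "kv_inv mem t \<longleftrightarrow> separating mem t \<and> [] \<in> leaves t \<and> (\<forall>d l r. t = Node d l r \<longrightarrow> d = [])"

text \<open>Just before the first disagreement, sifting and the hypothesis share a leaf
  \<open>u\<close>. The next letter takes \<open>u\<close> and the prefix read so far to different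
  leaves, so that letter followed by the ancestor's label tells them apart, and the prefix is a new
  leaf.\<close>

lemma kv_refine_invariant:
  assumes inv: "kv_inv mem t" and ce: "z \<in> dfa_lang (ctree_dfa mem t) \<longleftrightarrow> \<not> mem z"
  shows "kv_inv mem (kv_refine mem t z) \<and> leaves t \<subset> leaves (kv_refine mem t z)"
proof (cases t)
  case (Leaf s)
  with inv have [simp]: "s = []" by (simp add: kv_inv_def)
  have "dfa_run (ctree_dfa mem t) z = []"
    using ctree_dfa_run_in_leaves[of t mem z] Leaf by simp
  with ctree_dfa_lang_iff[of t z mem] ce Leaf have neq: "mem [] \<noteq> mem z"
    by auto
  then have "z \<noteq> []" by auto
  have "separating mem (split_node mem [] [] z)"
    using neq by (intro split_node_separating) simp
  moreover have "\<forall>d l r. split_node mem [] [] z = Node d l r \<longrightarrow> d = []"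
    by (simp add: split_node_def)
  ultimately show ?thesis
    using \<open>z \<noteq> []\<close> by (auto simp: Leaf kv_inv_def leaves_split_node)
next
  case (Node d l r)
  with inv have sep: "separating mem t" and nil: "[] \<in> leaves t" and [simp]: "d = []"
    by (auto simp: kv_inv_def)
  define sifted where "sifted i = sift mem t (take i z)" for i
  define hyp where "hyp i = dfa_run (ctree_dfa mem t) (take i z)" for i
  define j where "j = (LEAST i. sifted i \<noteq> hyp i)"
  \<comment> \<open>This makes the \<open>LEAST\<close> in \<open>j\<close> well defined.\<close>
  have "sifted (length z) \<noteq> hyp (length z)"
  proof
    assume "sifted (length z) = hyp (length z)"
    then have "mem (dfa_run (ctree_dfa mem t) z) \<longleftrightarrow> mem z"
      using mem_sift_root[of mem d l r z] sep Node by (simp add: sifted_def hyp_def)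
    with ctree_dfa_lang_iff[OF nil, of z mem] ce show False by simp
  qed
  then have j: "sifted j \<noteq> hyp j" "j \<le> length z" "\<And>i. i < j \<Longrightarrow> sifted i = hyp i"
    unfolding j_def by (fact LeastI, fact Least_le, use not_less_Least in blast)
  \<comment> \<open>Agreement at 0 makes \<open>j\<close> positive, so \<open>j - 1\<close> is a
    true predecessor.\<close>
  have "sifted 0 = hyp 0"
    using sift_leaf[OF sep nil] by (simp add: sifted_def hyp_def dfa_run_Nil ctree_dfa_def)
  with j(1) obtain i where i: "j = Suc i"
    by (cases j) auto
  let ?v = "take i z" and ?a = "z ! i"
  let ?c = "lca_label t (sifted j) (hyp j)"
  have u: "sift mem t ?v = hyp i"
    using j(3)[of i] by (simp add: i sifted_def)
  have s: "sifted j = sift mem t (?v @ [?a])" and h: "hyp j = sift mem t (hyp i @ [?a])"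
    using j(2) by (auto simp: i sifted_def hyp_def take_Suc_conv_app_nth dfa_run_snoc ctree_dfa_def)
  have neq: "mem (sift mem t ?v @ ?a # ?c) \<noteq> mem (?v @ ?a # ?c)"
    using lca_label_distinguishes[OF sep, of "?v @ [?a]" "hyp i @ [?a]"] j(1) by (auto simp: u s h)
  have ref: "kv_refine mem t z =
      replace_leaf (sift mem t ?v) (split_node mem (?a # ?c) (sift mem t ?v) ?v) t"
    unfolding Node kv_refine.simps Let_def
    unfolding Node[symmetric] sifted_def[symmetric] hyp_def[symmetric] j_def[symmetric]
    by (simp add: i)
  have "separating mem (kv_refine mem t z)" "leaves (kv_refine mem t z) = insert ?v (leaves t)"
    using replace_leaf_split_node[OF sep neq] by (simp_all add: ref)
  \<comment> \<open>A leaf sifts to itself, which would make the two sides of \<open>neq\<close>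
    equal.\<close>
  moreover have "?v \<notin> leaves t"
    using sift_leaf[OF sep] neq by fastforce
  moreover have "\<forall>d l r. kv_refine mem t z = Node d l r \<longrightarrow> d = []"
    unfolding ref by (simp add: Node)
  ultimately show ?thesis
    using nil by (auto simp: kv_inv_def)
qed

text \<open>Sifting depends only on the state of \<open>M\<close> reached, and every leaf is its own
  image.\<close>

lemma card_leaves_le:
  assumes "is_dfa M" "\<And>w. mem w \<longleftrightarrow> w \<in> dfa_lang M" "separating mem t"
  shows "card (leaves t) \<le> card (dfa_states M)"
proof -
  have "sift mem t u = sift mem t v" if "dfa_run M u = dfa_run M v" for u v
    using dfa_lang_append_cong[OF that] by (induction t) (auto simp: assms(2))
  from card_le_dfa_states(2)[where f = "sift mem t" and S = "leaves t", OF assms(1) this]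
  show ?thesis by (simp add: sift_leaf[OF assms(3)])
qed

lemma kearns_vazirani_terminates:
  fixes M :: "('q, 'a) dfa"
  assumes "is_dfa M" "dfa_lang M = reachable T I"
  shows "terminates_within kearns_vazirani I T B (card (dfa_states M))"
proof (rule terminates_within_by_rank[of "kv_inv (\<lambda>w. w \<in> reachable T I)" _ "\<lambda>t. card (leaves t)"])
  let ?mem = "\<lambda>w. w \<in> reachable T I"
  show "kv_inv ?mem (lrn_start kearns_vazirani)"
    by (simp add: kv_inv_def kearns_vazirani_def)
  show "0 < card (leaves t) \<and> card (leaves t) \<le> card (dfa_states M)" if "kv_inv ?mem t" for t
    using that card_leaves_le[OF assms(1), of ?mem t] assms(2)
    by (simp add: kv_inv_def card_gt_0_iff finite_leaves leaves_nonempty)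
  show "kv_inv ?mem (lrn_refine kearns_vazirani ?mem t z) \<and>
      (card (leaves t) < card (leaves (lrn_refine kearns_vazirani ?mem t z)) \<or>
       card (leaves t) \<le> card (leaves (lrn_refine kearns_vazirani ?mem t z)) \<and>
       (\<exists>t'. lrn_work kearns_vazirani ?mem (lrn_refine kearns_vazirani ?mem t z) t'))"
    if "kv_inv ?mem t" "z \<in> dfa_lang (lrn_hyp kearns_vazirani ?mem t) \<longleftrightarrow> \<not> ?mem z" for t z
    \<comment> \<open>With no internal steps, every counterexample has to raise the rank at
      once.\<close>
    using kv_refine_invariant[of ?mem t z] that
    by (simp add: kearns_vazirani_def psubset_card_mono finite_leaves)
qed (simp add: kearns_vazirani_def)

theorem mainTheorem2:
  fixes \<I> :: "('i, 'a :: finite) nfa"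
    and \<T> :: "('t, 'a \<times> 'a) nfa"
    and \<B> :: "('b, 'a) nfa"
    and M :: "('m, 'a) dfa"
    and I B :: "'a list set"
    and T :: "('a list \<times> 'a list) set"
    and k :: nat
  assumes "rmc_problem \<I> \<T> \<B>"
    and "I = nfa_lang \<I>" and "T = transducer_rel \<T>" and "B = nfa_lang \<B>"
    and "regular (reachable T I)"
    and "minimal_dfa M (reachable T I)" and "k = card (dfa_states M)"
  shows "terminates_within angluin I T B k
    \<and> terminates_within rivest_schapire I T B k
    \<and> terminates_within kearns_vazirani I T B k"
proof -
  from assms(6) have "is_dfa M" "dfa_lang M = reachable T I"
    by (simp_all add: minimal_dfa_def)
  then show ?thesis
    unfolding assms(7)
    by (intro conjI angluin_terminates rivest_schapire_terminates kearns_vazirani_terminates)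
qed

end
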